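(* Let $G$ be a graph of order $n$ and independence number $\alpha$ with $\alpha<n$. Then $$\sharp\alpha(G)\leq \left\lceil\frac{n}{\alpha}\right\rceil^{n\,{\rm mod}\,\alpha}\left\lfloor\frac{n}{\alpha}\right\rfloor^{\alpha-(n\,{\rm mod}\,\alpha)}.$$ Furthermore, equality holds in this inequality if and only if $G$ is (isomorphic to) the complement of $T_{\alpha}(n)$.
   Context: All graphs are finite, simple, and undirected. The order of a graph is its number of vertices. The independence number of $G$ is the maximum cardinality of a set of pairwise non-adjacent vertices (an independent set) of $G$. An independent set is maximum if its cardinality equals the independence number, and $\sharp\alpha(G)$ denotes the number of maximum independent sets in $G$. For positive integers $n$ and $p$, $n\,{\rm mod}\,p\in\{0,\ldots,p-1\}$ is the remainder of $n$ modulo $p$, and $T_p(n)$ (the Turán graph) is the complete $p$-partite graph with $n\,{\rm mod}\,p$ partite sets of order $\left\lceil\frac{n}{p}\right\rceil$ and $p-(n\,{\rm mod}\,p)$ partite sets of order $\left\lfloor\frac{n}{p}\right\rfloor$. *)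

theory Defs
  imports Complex_Main "Graph_Theory.Pair_Digraph" "Graph_Theory.Digraph_Isomorphism"
begin

(* Finite simple undirected graphs are the elements of the locale pair_graph: finite vertex set,
   and as arcs a symmetric, irreflexive set of ordered pairs of vertices, in which an edge uv is
   represented by the two arcs (u, v) and (v, u). Between two such graphs, digraph_iso is
   isomorphism of undirected graphs. *)

definition graph_order :: "'a pair_pre_digraph \<Rightarrow> nat" where
  "graph_order G = card (pverts G)"

definition indep_set :: "'a pair_pre_digraph \<Rightarrow> 'a set \<Rightarrow> bool" where
  "indep_set G S \<longleftrightarrow> S \<subseteq> pverts G \<and> pairwise (\<lambda>u v. (u, v) \<notin> parcs G) S"

definition independence_number :: "'a pair_pre_digraph \<Rightarrow> nat" where
  "independence_number G = Max {card S | S. indep_set G S}"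

definition max_indep_set :: "'a pair_pre_digraph \<Rightarrow> 'a set \<Rightarrow> bool" where
  "max_indep_set G S \<longleftrightarrow> indep_set G S \<and> card S = independence_number G"

definition num_max_indep_sets :: "'a pair_pre_digraph \<Rightarrow> nat" where
  "num_max_indep_sets G = card {S. max_indep_set G S}"

definition complement_graph :: "'a pair_pre_digraph \<Rightarrow> 'a pair_pre_digraph" where
  "complement_graph G =
    \<lparr> pverts = pverts G,
      parcs = {(u, v). u \<in> pverts G \<and> v \<in> pverts G \<and> u \<noteq> v \<and> (u, v) \<notin> parcs G} \<rparr>"

(* The i-th partite set (i < p) is {i} \<times> {..<s i}. *)
definition complete_multipartite :: "nat \<Rightarrow> (nat \<Rightarrow> nat) \<Rightarrow> (nat \<times> nat) pair_pre_digraph" where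
  "complete_multipartite p s =
    (let V = (SIGMA i:{..<p}. {..<s i})
     in \<lparr> pverts = V, parcs = {(u, v). u \<in> V \<and> v \<in> V \<and> fst u \<noteq> fst v} \<rparr>)"

definition turan_graph :: "nat \<Rightarrow> nat \<Rightarrow> (nat \<times> nat) pair_pre_digraph" where
  "turan_graph p n =
    complete_multipartite p
      (\<lambda>i. if i < n mod p then nat \<lceil>real n / real p\<rceil> else nat \<lfloor>real n / real p\<rfloor>)"

lemma pair_graph_complement_graph:
  assumes "pair_graph G"
  shows "pair_graph (complement_graph G)"
proof -
  interpret pair_graph G by fact
  have fin: "finite (parcs (complement_graph G))"
    by (rule finite_subset[of _ "pverts G \<times> pverts G"])
      (auto simp: complement_graph_def pair_finite_verts)
  have "(v, u) \<in> parcs G" if "(u, v) \<in> parcs G" for u v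
    using pair_sym_arcs that by (auto simp: symmetric_def dest: symD)
  then show ?thesis
    using fin by unfold_locales
      (auto simp: complement_graph_def pair_finite_verts symmetric_def intro!: symI)
qed

lemma pair_graph_complete_multipartite: "pair_graph (complete_multipartite p s)"
proof -
  let ?V = "SIGMA i:{..<p}. {..<s i}"
  have "finite (parcs (complete_multipartite p s))"
    by (rule finite_subset[of _ "?V \<times> ?V"]) (auto simp: complete_multipartite_def Let_def)
  then show ?thesis
    by unfold_locales (auto simp: complete_multipartite_def Let_def symmetric_def intro!: symI)
qed

lemma graph_order_turan_graph:
  assumes "p > 0"
  shows "graph_order (turan_graph p n) = n"
proof -
  define r where "r = n mod p"
  have fl: "nat \<lfloor>real n / real p\<rfloor> = n div p"
    by (simp add: floor_divide_of_nat_eq)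
  have ce: "nat \<lceil>real n / real p\<rceil> = n div p + 1" if "r > 0"
  proof -
    have "real n / real p \<noteq> real (n div p)"
    proof
      assume "real n / real p = real (n div p)"
      then have "real n = real (n div p * p)" using assms by (simp add: field_simps)
      then have "n = n div p * p" by linarith
      then show False using that unfolding r_def by (metis mod_mult_self2_is_0 not_less_zero)
    qed
    then have "real n / real p \<noteq> of_int \<lfloor>real n / real p\<rfloor>"
      by (simp add: floor_divide_of_nat_eq)
    then have "\<lceil>real n / real p\<rceil> = \<lfloor>real n / real p\<rfloor> + 1"
      by (metis ceiling_altdef)
    then show ?thesis by (simp add: nat_add_distrib fl)
  qed
  have "graph_order (turan_graph p n) = (\<Sum>i<p. n div p + (if i < r then 1 else 0))"
    using ce by (auto simp: graph_order_def turan_graph_def complete_multipartite_def Let_def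
        card_SigmaI fl r_def intro!: sum.cong)
  also have "\<dots> = p * (n div p) + card {i \<in> {..<p}. i < r}"
    by (simp add: sum.distrib flip: sum.inter_filter)
  also have "{i \<in> {..<p}. i < r} = {..<r}"
    using assms less_trans[of _ r p] by (auto simp: r_def)
  finally show ?thesis by (simp add: r_def)
qed

end

theory Submission
  imports Defs
begin

text \<open>
  Work with the cliques of the non-adjacency relation. Let \<open>v\<close> be a vertex in the largest number
  of maximum cliques, let \<open>A\<close> be its neighbourhood and \<open>B\<close> the complement of \<open>A\<close>. As \<open>A\<close> has a
  smaller clique number, every maximum clique meets \<open>B\<close>, so there are at most \<open>card B\<close> times as
  many of them as there are maximum cliques in \<open>A\<close>. By induction their number is bounded by a
  product of part sizes, and equality forces the graph to be complete multipartite with these parts.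
  With \<open>q = n div \<alpha>\<close>, Bernoulli's inequality bounds a part size \<open>s\<close> by \<open>q * (1 + 1 / q) powi (s - q)\<close>,
  with equality only for \<open>s = q\<close> and \<open>s = q + 1\<close>; the product of these bounds depends only on the
  sum of the part sizes.
\<close>

text \<open>The size \<open>k\<close> is prescribed and need not be the clique number. That no
  larger clique exists is expressed by \<open>cliques E (Suc k) V = {}\<close>, a form that passes
  from \<open>V\<close> to a neighbourhood with \<open>k\<close> lowered by one.\<close>

definition cliques :: "('a \<Rightarrow> 'a \<Rightarrow> bool) \<Rightarrow> nat \<Rightarrow> 'a set \<Rightarrow> 'a set set" where
  "cliques E k V = {S. S \<subseteq> V \<and> card S = k \<and> pairwise E S}"

text \<open>Complete multipartite structure with numbered, possibly empty parts. Only distinct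
  vertices are compared, because the intended \<open>E\<close>, non-adjacency, relates each vertex
  to itself.\<close>

definition multipartite_colouring ::
    "('a \<Rightarrow> 'a \<Rightarrow> bool) \<Rightarrow> 'a set \<Rightarrow> nat \<Rightarrow> (nat \<Rightarrow> nat) \<Rightarrow> ('a \<Rightarrow> nat) \<Rightarrow> bool" where
  "multipartite_colouring E V k s c \<longleftrightarrow>
    (\<forall>x\<in>V. c x < k) \<and> (\<forall>i<k. card {x \<in> V. c x = i} = s i) \<and>
    (\<forall>x\<in>V. \<forall>y\<in>V. x \<noteq> y \<longrightarrow> (E x y \<longleftrightarrow> c x \<noteq> c y))"

section \<open>Maximum cliques\<close>

lemma finite_cliques: "finite V \<Longrightarrow> finite (cliques E k V)"
  unfolding cliques_def by (rule finite_subset[of _ "Pow V"]) auto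

lemma insert_clique:
  assumes "finite V" "S \<in> cliques E k V" "u \<in> V" "u \<notin> S" "\<And>x. x \<in> S \<Longrightarrow> E u x"
    and "\<And>x y. E x y \<Longrightarrow> E y x"
  shows "insert u S \<in> cliques E (Suc k) V"
proof -
  have "finite S" using assms(1,2) finite_subset unfolding cliques_def by auto
  then show ?thesis using assms unfolding cliques_def by (auto simp: pairwise_insert)
qed

text \<open>A clique has at most one vertex in each part, so a clique of size \<open>k\<close> picks
  exactly one from each of the \<open>k\<close> parts. Such cliques are the ranges of the choice
  functions in \<open>PiE {..<k} F\<close>.\<close>

lemma card_cliques_eq_prod:
  assumes "finite V" and col: "multipartite_colouring E V k s c"
  shows "card (cliques E k V) = prod s {..<k}"
proof -
  define F where "F i = {x \<in> V. c x = i}" for i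
  have cF: "c (f i) = i" "f i \<in> V" if "f \<in> PiE {..<k} F" "i < k" for f i
    using PiE_mem[OF that(1), of i] that(2) unfolding F_def by auto
  \<comment> \<open>The colour of a chosen vertex reveals its index, so the range determines the
    choice function.\<close>
  have inj: "inj_on (\<lambda>f. f ` {..<k}) (PiE {..<k} F)"
  proof (rule inj_onI)
    fix f g assume f: "f \<in> PiE {..<k} F" and g: "g \<in> PiE {..<k} F"
      and eq: "f ` {..<k} = g ` {..<k}"
    show "f = g"
    proof (rule PiE_ext[OF f g])
      fix i assume "i \<in> {..<k}"
      then have i: "i < k" by simp
      then have "f i \<in> g ` {..<k}" unfolding eq[symmetric] by simp
      then obtain j where j: "j < k" "f i = g j" by auto
      then have "i = j" using cF[OF f i] cF[OF g j(1)] by simp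
      then show "f i = g i" using j by simp
    qed
  qed
  have img: "(\<lambda>f. f ` {..<k}) ` PiE {..<k} F = cliques E k V"
  proof (intro equalityI subsetI)
    fix S assume "S \<in> (\<lambda>f. f ` {..<k}) ` PiE {..<k} F"
    then obtain f where f: "f \<in> PiE {..<k} F" and S: "S = f ` {..<k}" by auto
    have "inj_on f {..<k}" using cF[OF f] by (metis inj_onI lessThan_iff)
    then have "card S = k" using S card_image by fastforce
    moreover have "S \<subseteq> V" using S cF[OF f] by auto
    moreover have "pairwise E S"
      using S cF[OF f] col unfolding pairwise_def multipartite_colouring_def
      by (smt (verit) imageE lessThan_iff)
    ultimately show "S \<in> cliques E k V" unfolding cliques_def by simp
  next
    fix S assume "S \<in> cliques E k V"
    then have S: "S \<subseteq> V" "card S = k" "pairwise E S" unfolding cliques_def by auto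
    have inj: "inj_on c S"
      using S col unfolding inj_on_def pairwise_def multipartite_colouring_def by blast
    moreover have "c ` S \<subseteq> {..<k}" using S col unfolding multipartite_colouring_def by auto
    ultimately have bij: "bij_betw c S {..<k}"
      using S by (simp add: bij_betw_def card_image card_subset_eq)
    \<comment> \<open>The colouring maps \<open>S\<close> bijectively onto the \<open>k\<close>
      colours; its inverse is the choice function with range \<open>S\<close>.\<close>
    define f where "f = restrict (the_inv_into S c) {..<k}"
    have bf: "bij_betw (the_inv_into S c) {..<k} S" using bij by (rule bij_betw_the_inv_into)
    then have 1: "f ` {..<k} = S" unfolding f_def by (simp add: bij_betw_def)
    have "f \<in> PiE {..<k} F"
    proof (rule PiE_I)
      fix i assume i: "i \<in> {..<k}"
      then have "f i \<in> S" using 1 by blast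
      moreover have "c (f i) = i"
        using i bij inj unfolding f_def by (simp add: bij_betw_def f_the_inv_into_f)
      ultimately show "f i \<in> F i" using S unfolding F_def by auto
    qed (simp add: f_def)
    then show "S \<in> (\<lambda>f. f ` {..<k}) ` PiE {..<k} F" using 1 by blast
  qed
  have "card (cliques E k V) = card (PiE {..<k} F)"
    using card_image[OF inj] img by simp
  also have "\<dots> = prod s {..<k}"
    using col unfolding F_def multipartite_colouring_def by (simp add: card_PiE)
  finally show ?thesis .
qed

text \<open>The sizes \<open>s\<close> come from the induction, each step appending
  \<open>card B\<close>. The equality clause demands a positive count: if the count and the product
  are both 0, as for a 5-cycle with \<open>k = 3\<close> and sizes 5, 0, 0, no structure
  follows.\<close>

lemma card_cliques_le_prod:
  assumes "finite V" and sym: "\<And>x y. E x y \<Longrightarrow> E y x" and "cliques E (Suc k) V = {}"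
  shows "\<exists>s. sum s {..<k} = card V \<and> card (cliques E k V) \<le> prod s {..<k} \<and>
    (card (cliques E k V) = prod s {..<k} \<and> card (cliques E k V) > 0 \<longrightarrow>
      (\<exists>c. multipartite_colouring E V k s c))"
  using assms(1,3)
proof (induction k arbitrary: V)
  case 0
  have "V = {}"
  proof (rule ccontr)
    assume "V \<noteq> {}"
    then obtain v where "v \<in> V" by blast
    then have "{v} \<in> cliques E (Suc 0) V" unfolding cliques_def by auto
    then show False using 0 by blast
  qed
  moreover have "cliques E 0 {} = {{}}" unfolding cliques_def by auto
  ultimately show ?case unfolding multipartite_colouring_def by auto
next
  case (Suc k)
  note fin = \<open>finite V\<close>
  let ?K = "cliques E (Suc k) V"
  define d where "d u = {S \<in> ?K. u \<in> S}" for u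
  show ?case
  proof (cases "V = {}")
    case True
    then have "?K = {}" unfolding cliques_def by auto
    \<comment> \<open>All parts get size 0; the equality clause is vacuous since there is no clique
      to count.\<close>
    then show ?thesis using True by (intro exI[of _ "\<lambda>_. 0"]) auto
  next
    case False
    obtain v where v: "v \<in> V" and vmax: "\<And>u. u \<in> V \<Longrightarrow> card (d u) \<le> card (d v)"
    proof -
      define M where "M = Max ((\<lambda>u. card (d u)) ` V)"
      have "M \<in> (\<lambda>u. card (d u)) ` V" unfolding M_def using fin False by (intro Max_in) auto
      then obtain v where "v \<in> V" "card (d v) = M" by auto
      then show ?thesis using that[of v] fin unfolding M_def by simp
    qed
    define A where "A = {u \<in> V. u \<noteq> v \<and> E v u}"
    define B where "B = V - A"
    have AV: "A \<subseteq> V" and BV: "B \<subseteq> V" and finA: "finite A" and finB: "finite B"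
      and vA: "v \<notin> A" and vB: "v \<in> B"
      using fin v unfolding A_def B_def by auto
    have finK: "finite ?K" using fin by (rule finite_cliques)
    have find: "finite (d u)" for u using finK unfolding d_def by simp
    \<comment> \<open>Adding \<open>v\<close> to such a clique would give one of size
      \<open>Suc (Suc k)\<close> in \<open>V\<close>. This makes the induction hypothesis applicable
      to \<open>A\<close> and forces every clique in \<open>?K\<close> to meet
      \<open>B\<close>.\<close>
    have A_empty: "cliques E (Suc k) A = {}"
    proof (rule ccontr)
      assume "cliques E (Suc k) A \<noteq> {}"
      then obtain S where S: "S \<in> cliques E (Suc k) A" by blast
      then have "S \<subseteq> A" "S \<in> ?K" using AV unfolding cliques_def by auto
      then have "insert v S \<in> cliques E (Suc (Suc k)) V"
        using vA v by (intro insert_clique[OF fin _ _ _ _ sym]) (auto simp: A_def)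
      then show False using Suc.prems by blast
    qed
    have "bij_betw (\<lambda>S. S - {v}) (d v) (cliques E k A)"
    proof (rule bij_betw_byWitness[where f' = "insert v"])
      show "(\<lambda>S. S - {v}) ` d v \<subseteq> cliques E k A"
        unfolding d_def cliques_def A_def by (auto simp: pairwise_def)
      show "insert v ` cliques E k A \<subseteq> d v"
      proof safe
        fix T assume T: "T \<in> cliques E k A"
        then have "T \<subseteq> A" "T \<in> cliques E k V" using AV unfolding cliques_def by auto
        then have "insert v T \<in> ?K"
          using vA v by (intro insert_clique[OF fin _ _ _ _ sym]) (auto simp: A_def)
        then show "insert v T \<in> d v" unfolding d_def by simp
      qed
      show "\<forall>S\<in>d v. insert v (S - {v}) = S" unfolding d_def by auto
      show "\<forall>T\<in>cliques E k A. insert v T - {v} = T" using vA unfolding cliques_def by auto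
    qed
    then have card_dv: "card (d v) = card (cliques E k A)" by (rule bij_betw_same_card)
    have meets: "S \<inter> B \<noteq> {}" if "S \<in> ?K" for S
      using that A_empty unfolding B_def cliques_def by blast
    \<comment> \<open>Double counting of the pairs of a vertex \<open>u\<close> in \<open>B\<close>
      and a clique in \<open>?K\<close> containing \<open>u\<close>.\<close>
    have double: "(\<Sum>u\<in>B. card (d u)) = (\<Sum>S\<in>?K. card (S \<inter> B))"
    proof -
      have "(\<Sum>u\<in>B. card (d u)) = (\<Sum>u\<in>B. \<Sum>S\<in>?K. if u \<in> S then 1 else 0)"
        unfolding d_def using finK by (simp flip: sum.inter_filter)
      also have "\<dots> = (\<Sum>S\<in>?K. \<Sum>u\<in>B. if u \<in> S then 1 else 0)" by (rule sum.swap)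
      also have "\<dots> = (\<Sum>S\<in>?K. card (S \<inter> B))"
        using finB by (intro sum.cong) (simp_all add: Int_def conj_commute flip: sum.inter_filter)
      finally show ?thesis .
    qed
    have one: "1 \<le> card (S \<inter> B)" if "S \<in> ?K" for S
      using meets[OF that] finB by (simp add: Suc_le_eq card_gt_0_iff)
    have le1: "card ?K \<le> (\<Sum>S\<in>?K. card (S \<inter> B))"
      using sum_mono[of ?K "\<lambda>_. 1::nat", OF one] by simp
    have le2: "(\<Sum>u\<in>B. card (d u)) \<le> card B * card (d v)"
      using sum_bounded_above[of B "\<lambda>u. card (d u)" "card (d v)"] vmax BV by auto
    obtain s where s: "sum s {..<k} = card A" "card (cliques E k A) \<le> prod s {..<k}"
      and col: "card (cliques E k A) = prod s {..<k} \<Longrightarrow> card (cliques E k A) > 0 \<Longrightarrow>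
        (\<exists>c. multipartite_colouring E A k s c)"
      using Suc.IH[OF finA A_empty] by blast
    have le3: "card B * card (d v) \<le> card B * prod s {..<k}"
      using s(2) card_dv by simp
    define s' where "s' = s(k := card B)"
    have "sum s' {..<k} = sum s {..<k}" "prod s' {..<k} = prod s {..<k}"
      unfolding s'_def by (auto intro: sum.cong prod.cong)
    then have sum': "sum s' {..<Suc k} = card A + card B"
      and prod': "prod s' {..<Suc k} = card B * prod s {..<k}"
      using s(1) by (simp_all add: s'_def)
    have cardV: "card A + card B = card V"
      unfolding B_def using AV fin finA by (simp add: card_Diff_subset card_mono)
    have "\<exists>c. multipartite_colouring E V (Suc k) s' c"
      if eq: "card ?K = card B * prod s {..<k}" and pos: "card ?K > 0"
    proof -
      have Bpos: "card B > 0" using vB finB by (auto simp: card_gt_0_iff)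
      \<comment> \<open>Equality of the two ends makes every link of the chain tight: each clique
        meets \<open>B\<close> in one vertex, each vertex of \<open>B\<close> lies in as many
        cliques as \<open>v\<close>, and \<open>A\<close> attains its own bound.\<close>
      have eqs: "card ?K = (\<Sum>S\<in>?K. card (S \<inter> B))"
          "(\<Sum>u\<in>B. card (d u)) = card B * card (d v)"
          "card B * card (d v) = card B * prod s {..<k}"
        using le1 le2 le3 double eq by linarith+
      have dv: "card (d v) = prod s {..<k}" using eqs(3) Bpos by simp
      have pos': "card (cliques E k A) > 0" using pos eq dv card_dv by (metis mult_0_right not_gr0)
      obtain c where c: "multipartite_colouring E A k s c"
        using col pos' dv card_dv by auto
      have SB: "card (S \<inter> B) = 1" if "S \<in> ?K" for S
      proof (rule ccontr)
        assume "card (S \<inter> B) \<noteq> 1"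
        then have "1 < card (S \<inter> B)" using one[OF that] by simp
        then have "(\<Sum>S\<in>?K. 1) < (\<Sum>S\<in>?K. card (S \<inter> B))"
          using that one by (intro sum_strict_mono_ex1[OF finK]) auto
        then show False using eqs(1) by simp
      qed
      have du: "card (d u) = card (d v)" if "u \<in> B" for u
      proof (rule ccontr)
        assume "card (d u) \<noteq> card (d v)"
        then have "card (d u) < card (d v)" using vmax[of u] that BV by (simp add: subset_iff)
        then have "(\<Sum>u\<in>B. card (d u)) < (\<Sum>u\<in>B. card (d v))"
          using that BV vmax by (intro sum_strict_mono_ex1[OF finB]) auto
        then show False using eqs(2) by simp
      qed
      \<comment> \<open>Deleting \<open>u\<close> maps \<open>d u\<close> injectively into the
        cliques of size \<open>k\<close> in \<open>A\<close>. The two sets have equal cardinality,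
        so the map is onto and each such clique extends by \<open>u\<close>.\<close>
      have ext: "insert u T \<in> ?K" if u: "u \<in> B" and T: "T \<in> cliques E k A" for u T
      proof -
        have sub: "(\<lambda>S. S - {u}) ` d u \<subseteq> cliques E k A"
        proof safe
          fix S assume "S \<in> d u"
          then have S: "S \<in> ?K" "u \<in> S" unfolding d_def by auto
          then have "S \<inter> B = {u}" using SB[OF S(1)] u by (metis IntI card_1_singletonE singletonD)
          then have "S - {u} \<subseteq> A" using S unfolding cliques_def B_def by auto
          then show "S - {u} \<in> cliques E k A"
            using S unfolding cliques_def by (auto simp: pairwise_def)
        qed
        have "inj_on (\<lambda>S. S - {u}) (d u)" unfolding d_def inj_on_def by blast
        then have "card ((\<lambda>S. S - {u}) ` d u) = card (cliques E k A)"
          using du[OF u] card_dv by (simp add: card_image)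
        then have "(\<lambda>S. S - {u}) ` d u = cliques E k A"
          using sub finite_cliques[OF finA] by (simp add: card_subset_eq)
        then obtain S where "S \<in> d u" "T = S - {u}" using T by blast
        then have "insert u T = S" "S \<in> ?K" unfolding d_def by auto
        then show ?thesis by simp
      qed
      obtain T0 where T0: "T0 \<in> cliques E k A" using pos' by (metis card.empty ex_in_conv less_irrefl)
      have T0A: "T0 \<subseteq> A" "card T0 = k" "pairwise E T0" using T0 unfolding cliques_def by auto
      have finT0: "finite T0" using T0A finA finite_subset by blast
      have inj: "inj_on c T0"
        using T0A c unfolding inj_on_def pairwise_def multipartite_colouring_def by blast
      moreover have "c ` T0 \<subseteq> {..<k}" using T0A c unfolding multipartite_colouring_def by auto
      ultimately have T0c: "c ` T0 = {..<k}"
        using T0A by (simp add: card_image card_subset_eq)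
      \<comment> \<open>The clique \<open>T0\<close> has one vertex of each colour in
        \<open>A\<close>. Exchanging its vertex of the colour of \<open>a\<close> for
        \<open>a\<close> gives a clique through \<open>a\<close>, and \<open>ext\<close> joins
        \<open>u\<close> to all of it.\<close>
      have EAB: "E u a" if u: "u \<in> B" and a: "a \<in> A" for u a
      proof -
        have "c a \<in> c ` T0" using T0c a c unfolding multipartite_colouring_def by auto
        then obtain t where t: "t \<in> T0" "c t = c a" by auto
        have ne: "c x \<noteq> c a" if "x \<in> T0 - {t}" for x
          using that t inj by (metis DiffE inj_onD singletonI)
        have "pairwise E (insert a (T0 - {t}))"
          using c a ne T0A t unfolding multipartite_colouring_def
          by (auto simp: pairwise_insert pairwise_def subset_iff)
        moreover have "a \<notin> T0 - {t}" using ne by blast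
        then have "card (insert a (T0 - {t})) = k"
          using finT0 t T0A by (metis card.remove card_insert_disjoint finite_Diff)
        ultimately have "insert a (T0 - {t}) \<in> cliques E k A"
          using a T0A unfolding cliques_def by auto
        from ext[OF u this] have "pairwise E (insert u (insert a (T0 - {t})))"
          unfolding cliques_def by simp
        moreover have "u \<noteq> a" using u a unfolding B_def by auto
        ultimately show ?thesis unfolding pairwise_def by auto
      qed
      \<comment> \<open>Two related vertices of \<open>B\<close> together with \<open>T0\<close>
        would form a clique of size \<open>Suc (Suc k)\<close>. Hence \<open>B\<close> can serve as
        the new part, with colour \<open>k\<close>.\<close>
      have EBB: "\<not> E u w" if u: "u \<in> B" and w: "w \<in> B" and "u \<noteq> w" for u w
      proof
        assume E: "E u w"
        have "insert u (insert w T0) \<in> cliques E (Suc (Suc k)) V"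
          using u w E EAB[OF u] T0A BV \<open>u \<noteq> w\<close>
          by (intro insert_clique[OF fin ext[OF w T0] _ _ _ sym]) (auto simp: B_def)
        then show False using Suc.prems by blast
      qed
      define c' where "c' x = (if x \<in> B then k else c x)" for x
      have V: "V = A \<union> B" "A \<inter> B = {}" using AV unfolding B_def by auto
      have ca: "c x < k" if "x \<in> A" for x using that c unfolding multipartite_colouring_def by auto
      have "multipartite_colouring E V (Suc k) s' c'"
        unfolding multipartite_colouring_def
      proof (intro conjI ballI allI impI)
        fix x assume "x \<in> V"
        then show "c' x < Suc k" using V ca unfolding c'_def by (auto simp: less_Suc_eq)
      next
        fix i assume i: "i < Suc k"
        show "card {x \<in> V. c' x = i} = s' i"
        proof (cases "i = k")
          case True
          then have "{x \<in> V. c' x = i} = B" using V ca unfolding c'_def by force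
          then show ?thesis using True unfolding s'_def by simp
        next
          case False
          then have "{x \<in> V. c' x = i} = {x \<in> A. c x = i}" using V unfolding c'_def by auto
          then show ?thesis
            using False i c unfolding s'_def multipartite_colouring_def by simp
        qed
      next
        fix x y assume xy: "x \<in> V" "y \<in> V" "x \<noteq> y"
        consider "x \<in> A" "y \<in> A" | "x \<in> A" "y \<in> B" | "x \<in> B" "y \<in> A" | "x \<in> B" "y \<in> B"
          using xy V by blast
        then show "E x y \<longleftrightarrow> c' x \<noteq> c' y"
        proof cases
          case 1
          then show ?thesis using V c xy unfolding c'_def multipartite_colouring_def by auto
        next
          case 2
          then show ?thesis using V ca[of x] sym[OF EAB[of y x]] unfolding c'_def by auto
        next
          case 3
          then show ?thesis using V ca[of y] EAB[of x y] unfolding c'_def by auto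
        next
          case 4
          then show ?thesis using EBB xy unfolding c'_def by auto
        qed
      qed
      then show ?thesis by blast
    qed
    moreover have "card ?K \<le> card B * prod s {..<k}" using le1 le2 le3 double by linarith
    moreover have "sum s' {..<Suc k} = card V" using sum' cardV by simp
    ultimately show ?thesis
      unfolding prod'[symmetric] by (intro exI[of _ s'] conjI impI; (elim conjE)?; assumption?) simp
  qed
qed

section \<open>Products of naturals with a fixed sum\<close>

text \<open>The function \<open>g\<close> is the exponential through the points (q, q) and (q+1,
  q+1), and by convexity it lies strictly above the diagonal at all other naturals. Dividing by the
  power with exponent \<open>q\<close> avoids negative exponents.\<close>

lemma nat_le_geometric:
  fixes q s :: nat
  assumes "q > 0"
  defines "g \<equiv> \<lambda>m::nat. real q * (1 + 1 / real q) ^ m / (1 + 1 / real q) ^ q"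
  shows "real s \<le> g s" and "real s = g s \<Longrightarrow> s = q \<or> s = q + 1"
proof -
  have g_Suc: "g (Suc m) = g m * (1 + 1 / real q)" for m unfolding g_def by simp
  have gq: "g q = q" using assms(1) unfolding g_def
    by (simp add: add_pos_pos less_imp_neq[symmetric])
  have gq1: "g (Suc q) = Suc q" using assms(1) unfolding g_Suc gq by (simp add: field_simps)
  have up: "real m < g m" if "m \<ge> Suc (Suc q)" for m
  proof -
    \<comment> \<open>Above \<open>q\<close>, passing to the successor multiplies the argument by
      less than \<open>1 + 1 / q\<close>, the constant ratio of \<open>g\<close>. Below
      \<open>q\<close> the comparison is reversed, so there the induction runs downwards from
      \<open>q\<close>.\<close>
    have le: "real m < g m" if "real q + 1 \<le> real m'" "real m' \<le> g m'" "m = Suc m'" for m m'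
    proof -
      have "real m < real m' + real m' / real q"
        using that(1,3) assms(1) by (simp add: field_simps)
      also have "\<dots> = real m' * (1 + 1 / real q)" by (simp add: field_simps)
      also have "\<dots> \<le> g m" unfolding that(3) g_Suc using that(2) by (intro mult_right_mono) auto
      finally show ?thesis .
    qed
    show ?thesis using that
    proof (induction rule: dec_induct)
      case base
      show ?case using gq1 by (intro le[of "Suc q"]) auto
    next
      case (step m)
      then show ?case by (intro le[of m]) auto
    qed
  qed
  have down: "real m < g m" if "m < q" for m
  proof -
    have le: "real m < g m" if "m < q" "real (Suc m) \<le> g (Suc m)" for m
    proof -
      have "real m * (1 + 1 / real q) < real (Suc m)"
        using that(1) assms(1) by (simp add: field_simps)
      also have "\<dots> \<le> g m * (1 + 1 / real q)" using that(2) unfolding g_Suc .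
      finally show ?thesis by (rule mult_right_less_imp_less) simp
    qed
    have "m \<le> q" using that by simp
    then have "real m \<le> g m"
    proof (induction rule: inc_induct)
      case base
      show ?case using gq by simp
    next
      case (step m)
      then show ?case using le[of m] by simp
    qed
    moreover have "real (Suc m) \<le> g (Suc m)"
      using \<open>m < q\<close>[THEN Suc_leI]
    proof (induction rule: inc_induct)
      case base
      show ?case using gq by simp
    next
      case (step m)
      then show ?case using le[of m] by simp
    qed
    ultimately show ?thesis using le[OF that] by simp
  qed
  show "real s \<le> g s" "real s = g s \<Longrightarrow> s = q \<or> s = q + 1"
    using up[of s] down[of s] gq gq1
    by (metis Suc_eq_plus1 less_irrefl less_le_not_le linorder_not_less nle_le not_less_eq_eq order_antisym_conv)+
qed

text \<open>Each factor is replaced by its exponential bound. The product of these bounds depends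
  only on the sum of the exponents, hence on \<open>n\<close>, and it equals the balanced product.
  The hypothesis \<open>k \<le> n\<close> ensures \<open>q > 0\<close>.\<close>

lemma prod_le_balanced:
  fixes s :: "nat \<Rightarrow> nat"
  assumes k: "k > 0" and sum: "sum s {..<k} = n" and n: "k \<le> n"
  defines "q \<equiv> n div k" and "r \<equiv> n mod k"
  shows "prod s {..<k} \<le> (q + 1) ^ r * q ^ (k - r)"
    and "prod s {..<k} = (q + 1) ^ r * q ^ (k - r) \<Longrightarrow> i < k \<Longrightarrow> s i = q \<or> s i = q + 1"
proof -
  have q: "q > 0" unfolding q_def using k n by (simp add: div_greater_zero_iff)
  have r: "r < k" unfolding r_def using k by simp
  define b where "b = 1 + 1 / real q"
  have b: "b > 0" unfolding b_def by (simp add: add_pos_nonneg)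
  \<comment> \<open>After cancellation \<open>b ^ r\<close> remains next to \<open>q ^ k\<close>;
    this identity lets it turn \<open>r\<close> of the factors \<open>q\<close> into
    \<open>q + 1\<close>.\<close>
  have qb: "real q * b = real (q + 1)" using q unfolding b_def by (simp add: field_simps)
  define g where "g m = real q * b ^ m / b ^ q" for m :: nat
  have "(\<Prod>i<k. g (s i)) = (\<Prod>i<k. real q / b ^ q) * (\<Prod>i<k. b ^ s i)"
    unfolding g_def prod.distrib[symmetric] by simp
  also have "\<dots> = real q ^ k / b ^ (q * k) * b ^ n"
    using sum by (simp add: power_divide power_mult flip: power_sum)
  also have "n = q * k + r" unfolding q_def r_def by simp
  also have "real q ^ k / b ^ (q * k) * b ^ (q * k + r) = real q ^ k * b ^ r"
    using b by (simp add: power_add)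
  also have "real q ^ k = real q ^ r * real q ^ (k - r)" using r by (simp flip: power_add)
  also have "real q ^ r * real q ^ (k - r) * b ^ r = real ((q + 1) ^ r * q ^ (k - r))"
    unfolding of_nat_mult of_nat_power qb[symmetric] by (simp add: power_mult_distrib)
  finally have prod_g: "(\<Prod>i<k. g (s i)) = real ((q + 1) ^ r * q ^ (k - r))" .
  have le: "real (s i) \<le> g (s i)" for i
    using nat_le_geometric(1)[OF q] unfolding g_def b_def .
  have "real (prod s {..<k}) \<le> (\<Prod>i<k. g (s i))"
    unfolding of_nat_prod using le by (intro prod_mono) auto
  then show "prod s {..<k} \<le> (q + 1) ^ r * q ^ (k - r)" unfolding prod_g by linarith
  show "s i = q \<or> s i = q + 1" if eq: "prod s {..<k} = (q + 1) ^ r * q ^ (k - r)" and i: "i < k"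
  proof (rule ccontr)
    assume "\<not> (s i = q \<or> s i = q + 1)"
    then have "real (s i) \<noteq> g (s i)"
      using nat_le_geometric(2)[OF q, of "s i"] unfolding g_def b_def by blast
    then have lt: "real (s i) < g (s i)" using le[of i] by simp
    \<comment> \<open>The bounds are positive even where some \<open>s j\<close> is 0, so strictness
      at the single index \<open>i\<close> carries over to the product.\<close>
    have "g j > 0" for j unfolding g_def using q b by simp
    then have "real (prod s {..<k}) < (\<Prod>i<k. g (s i))"
      unfolding of_nat_prod
      using i lt le by (intro prod_mono_strict[of i]) auto
    then show False unfolding prod_g eq by simp
  qed
qed

text \<open>The excess of the sum over \<open>k * (n div k)\<close> counts the larger entries, so
  there are \<open>n mod k\<close> of them. The permutation moves them to the front, the order used
  in \<open>turan_graph\<close>.\<close>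

lemma balanced_permutation:
  fixes s :: "nat \<Rightarrow> nat"
  assumes k: "k > 0" and sum: "sum s {..<k} = n"
    and bal: "\<And>i. i < k \<Longrightarrow> s i = n div k \<or> s i = n div k + 1"
  shows "\<exists>p. bij_betw p {..<k} {..<k} \<and>
    (\<forall>i<k. s i = (if p i < n mod k then n div k + 1 else n div k))"
proof -
  define q where "q = n div k"
  define r where "r = n mod k"
  have r: "r < k" unfolding r_def using k by simp
  define X where "X = {i \<in> {..<k}. s i = q + 1}"
  define Y where "Y = {i \<in> {..<k}. s i = q}"
  have XY: "{..<k} = X \<union> Y" "X \<inter> Y = {}" using bal unfolding X_def Y_def q_def by auto
  have fin: "finite X" "finite Y" unfolding X_def Y_def by auto
  have "n = (\<Sum>i<k. q + (if i \<in> X then 1 else 0))"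
    using bal unfolding X_def q_def sum[symmetric] by (intro sum.cong) force+
  also have "\<dots> = k * q + card X"
    unfolding sum.distrib X_def by (simp flip: sum.inter_filter)
  finally have X: "card X = r" unfolding q_def r_def
    by (metis add_left_cancel mult_div_mod_eq)
  have "k = card X + card Y" using card_Un_disjoint[OF fin XY(2)] XY(1) by (metis card_lessThan)
  then have Y: "card Y = card {r..<k}" using X by simp
  obtain f where f: "bij_betw f X {..<r}"
    using X fin finite_same_card_bij[of X "{..<r}"] by auto
  obtain g where g: "bij_betw g Y {r..<k}"
    using Y fin finite_same_card_bij[of Y "{r..<k}"] by auto
  define p where "p i = (if i \<in> X then f i else g i)" for i
  have "bij_betw p X {..<r}" using f by (simp add: p_def cong: bij_betw_cong)
  moreover have "bij_betw p Y {r..<k}"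
    using g XY(2) by (subst bij_betw_cong[of Y p g]) (auto simp: p_def)
  ultimately have "bij_betw p (X \<union> Y) ({..<r} \<union> {r..<k})" by (rule bij_betw_combine) auto
  moreover have "{..<r} \<union> {r..<k} = {..<k}" using r by auto
  ultimately have "bij_betw p {..<k} {..<k}" using XY by simp
  moreover have "s i = (if p i < r then q + 1 else q)" if "i < k" for i
  proof (cases "i \<in> X")
    case True
    then have "p i < r" using f unfolding p_def by (auto simp: bij_betw_def)
    then show ?thesis using True unfolding X_def by simp
  next
    case False
    then have "i \<in> Y" using XY that by auto
    then have "p i \<in> {r..<k}" using g False unfolding p_def by (auto simp: bij_betw_def)
    then show ?thesis using \<open>i \<in> Y\<close> unfolding Y_def by simp
  qed
  ultimately show ?thesis unfolding q_def r_def by blast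
qed

section \<open>Isomorphism with a complement of a Turan graph\<close>

text \<open>Reduces an isomorphism with separate vertex and arc maps to a vertex bijection. Arcs are
  pairs of vertices, so the arc map has to apply \<open>h\<close> to both ends.\<close>

lemma digraph_iso_with_proj_iff:
  assumes "pair_wf_digraph G" "pair_wf_digraph H"
  shows "digraph_iso (with_proj G) (with_proj H) \<longleftrightarrow>
    (\<exists>h. bij_betw h (pverts G) (pverts H) \<and>
      (\<forall>u\<in>pverts G. \<forall>v\<in>pverts G. (u, v) \<in> parcs G \<longleftrightarrow> (h u, h v) \<in> parcs H))"
    (is "?L \<longleftrightarrow> ?R")
proof
  interpret G: pair_wf_digraph G by fact
  assume ?L
  then obtain f where iso: "pre_digraph.digraph_isomorphism (with_proj G) f"
    and H: "with_proj H = app_iso f (with_proj G)"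
    unfolding digraph_iso_def by blast
  define h where "h = iso_verts f"
  \<comment> \<open>The tail and head functions of \<open>app_iso\<close> are those stored in
    \<open>f\<close>; equality with \<open>with_proj H\<close> forces them to be the
    projections.\<close>
  have pv: "pverts H = h ` pverts G" and pa: "parcs H = iso_arcs f ` parcs G"
    and tl: "iso_tail f = fst" and hd: "iso_head f = snd"
    using H unfolding with_proj_def app_iso_def h_def by auto
  have inj: "inj_on h (pverts G)"
    using iso unfolding pre_digraph.digraph_isomorphism_def h_def by simp
  have arc: "iso_arcs f (u, v) = (h u, h v)" if "(u, v) \<in> parcs G" for u v
    using iso that tl hd unfolding pre_digraph.digraph_isomorphism_def h_def
    by (auto intro!: prod_eqI)
  have "(u, v) \<in> parcs G \<longleftrightarrow> (h u, h v) \<in> parcs H" if "u \<in> pverts G" "v \<in> pverts G" for u v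
  proof
    assume "(u, v) \<in> parcs G"
    then show "(h u, h v) \<in> parcs H" using arc pa by (metis imageI)
  next
    assume "(h u, h v) \<in> parcs H"
    then obtain u' v' where a: "(u', v') \<in> parcs G" "(h u, h v) = iso_arcs f (u', v')"
      using pa by auto
    then have "h u = h u'" "h v = h v'" using arc by auto
    then have "u = u'" "v = v'"
      using that G.in_arcsD1[OF a(1)] G.in_arcsD2[OF a(1)] inj by (auto dest: inj_onD)
    then show "(u, v) \<in> parcs G" using a by simp
  qed
  then show ?R using pv inj unfolding bij_betw_def by blast
next
  interpret G: pair_wf_digraph G by fact
  interpret H: pair_wf_digraph H by fact
  assume ?R
  then obtain h where h: "bij_betw h (pverts G) (pverts H)"
    and arc: "\<And>u v. u \<in> pverts G \<Longrightarrow> v \<in> pverts G \<Longrightarrow>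
      (u, v) \<in> parcs G \<longleftrightarrow> (h u, h v) \<in> parcs H"
    by blast
  define f where "f = \<lparr> iso_verts = h, iso_arcs = map_prod h h,
    iso_head = snd, iso_tail = (fst :: 'b \<times> 'b \<Rightarrow> 'b) \<rparr>"
  have sub: "parcs G \<subseteq> pverts G \<times> pverts G" using G.in_arcsD1 G.in_arcsD2 by auto
  have "inj_on (map_prod h h) (parcs G)"
    using h map_prod_inj_on[of h "pverts G" h "pverts G"] inj_on_subset[OF _ sub]
    unfolding bij_betw_def by simp
  then have "pre_digraph.digraph_isomorphism (with_proj G) f"
    using h assms(1) unfolding pre_digraph.digraph_isomorphism_def f_def bij_betw_def
    by (auto simp: wf_digraph_wp_iff)
  moreover have "map_prod h h ` parcs G = parcs H"
  proof (intro equalityI subsetI)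
    fix e assume "e \<in> map_prod h h ` parcs G"
    then show "e \<in> parcs H" using arc sub by auto
  next
    fix e assume e: "e \<in> parcs H"
    obtain x y where xy: "e = (x, y)" by (cases e)
    obtain u v where "u \<in> pverts G" "v \<in> pverts G" "x = h u" "y = h v"
      using H.in_arcsD1 H.in_arcsD2 e h xy unfolding bij_betw_def by blast
    then show "e \<in> map_prod h h ` parcs G" using arc e xy by force
  qed
  then have "with_proj H = app_iso f (with_proj G)"
    using h unfolding app_iso_def f_def with_proj_def bij_betw_def by simp
  ultimately show ?L unfolding digraph_iso_def by blast
qed

lemma multipartite_colouring_permute:
  assumes col: "multipartite_colouring E V k s c" and p: "bij_betw p {..<k} {..<k}"
    and t: "\<And>i. i < k \<Longrightarrow> s i = t (p i)"
  shows "multipartite_colouring E V k t (p \<circ> c)"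
proof -
  have c: "c x < k" if "x \<in> V" for x using col that unfolding multipartite_colouring_def by simp
  have inj: "p i = p j \<longleftrightarrow> i = j" if "i < k" "j < k" for i j
    using p that unfolding bij_betw_def by (auto dest: inj_onD)
  have "card {x \<in> V. (p \<circ> c) x = j} = t j" if "j < k" for j
  proof -
    obtain i where i: "i < k" "j = p i" using p \<open>j < k\<close> unfolding bij_betw_def by auto
    then have "{x \<in> V. (p \<circ> c) x = j} = {x \<in> V. c x = i}" using inj c by auto
    then show ?thesis using col t i unfolding multipartite_colouring_def by simp
  qed
  moreover have "p (c x) < k" if "x \<in> V" for x
    using p c[OF that] unfolding bij_betw_def by auto
  ultimately show ?thesis
    using col inj c unfolding multipartite_colouring_def by auto
qed

text \<open>The complement of a complete multipartite graph is a disjoint union of complete graphs.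
  The first component of an isomorphism is a colouring; conversely, numbering each colour class
  supplies the second component.\<close>

lemma iso_complement_multipartite_iff:
  assumes "pair_graph G"
  shows "digraph_iso (with_proj G) (with_proj (complement_graph (complete_multipartite k s))) \<longleftrightarrow>
    (\<exists>c. multipartite_colouring (\<lambda>u v. (u, v) \<notin> parcs G) (pverts G) k s c)"
    (is "?L \<longleftrightarrow> ?R")
proof -
  interpret G: pair_graph G by fact
  let ?H = "complement_graph (complete_multipartite k s)"
  let ?V = "SIGMA i:{..<k}. {..<s i}"
  have pvH: "pverts ?H = ?V" and
    paH: "parcs ?H = {(u, v). u \<in> ?V \<and> v \<in> ?V \<and> u \<noteq> v \<and> fst u = fst v}"
    unfolding complement_graph_def complete_multipartite_def Let_def by auto
  have "pair_graph ?H"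
    by (intro pair_graph_complement_graph pair_graph_complete_multipartite)
  then interpret H: pair_graph ?H .
  have iff: "?L \<longleftrightarrow> (\<exists>h. bij_betw h (pverts G) ?V \<and>
      (\<forall>u\<in>pverts G. \<forall>v\<in>pverts G. (u, v) \<in> parcs G \<longleftrightarrow> (h u, h v) \<in> parcs ?H))"
    using digraph_iso_with_proj_iff[OF G.pair_wf_digraph H.pair_wf_digraph] pvH by simp
  show ?thesis unfolding iff
  proof
    assume "\<exists>h. bij_betw h (pverts G) ?V \<and>
      (\<forall>u\<in>pverts G. \<forall>v\<in>pverts G. (u, v) \<in> parcs G \<longleftrightarrow> (h u, h v) \<in> parcs ?H)"
    then obtain h where h: "bij_betw h (pverts G) ?V"
      and arc: "\<And>u v. u \<in> pverts G \<Longrightarrow> v \<in> pverts G \<Longrightarrow>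
        (u, v) \<in> parcs G \<longleftrightarrow> (h u, h v) \<in> parcs ?H" by blast
    have hV: "h u \<in> ?V" if "u \<in> pverts G" for u using h that unfolding bij_betw_def by auto
    have inj: "h u = h v \<longleftrightarrow> u = v" if "u \<in> pverts G" "v \<in> pverts G" for u v
      using h that unfolding bij_betw_def by (auto dest: inj_onD)
    have "multipartite_colouring (\<lambda>u v. (u, v) \<notin> parcs G) (pverts G) k s (fst \<circ> h)"
      unfolding multipartite_colouring_def
    proof (intro conjI ballI allI impI)
      show "(fst \<circ> h) x < k" if "x \<in> pverts G" for x using hV[OF that] by auto
      show "(x, y) \<notin> parcs G \<longleftrightarrow> (fst \<circ> h) x \<noteq> (fst \<circ> h) y"
        if "x \<in> pverts G" "y \<in> pverts G" "x \<noteq> y" for x y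
        using arc[OF that(1,2)] hV[OF that(1)] hV[OF that(2)] inj[OF that(1,2)] that(3)
        unfolding paH by simp
      show "card {x \<in> pverts G. (fst \<circ> h) x = i} = s i" if "i < k" for i
      proof -
        have "h ` {x \<in> pverts G. (fst \<circ> h) x = i} = {i} \<times> {..<s i}"
        proof (intro equalityI subsetI)
          fix y assume "y \<in> h ` {x \<in> pverts G. (fst \<circ> h) x = i}"
          then show "y \<in> {i} \<times> {..<s i}" using hV by fastforce
        next
          fix y assume y: "y \<in> {i} \<times> {..<s i}"
          then have "y \<in> h ` pverts G" using h that unfolding bij_betw_def by auto
          then obtain x where "x \<in> pverts G" "y = h x" by blast
          then show "y \<in> h ` {x \<in> pverts G. (fst \<circ> h) x = i}" using y
            by (intro image_eqI[of _ _ x]) auto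
        qed
        moreover have "inj_on h {x \<in> pverts G. (fst \<circ> h) x = i}"
          using inj by (auto intro!: inj_onI)
        ultimately have "card {x \<in> pverts G. (fst \<circ> h) x = i} = card ({i} \<times> {..<s i})"
          by (metis card_image)
        then show ?thesis by (simp add: card_cartesian_product)
      qed
    qed
    then show ?R by blast
  next
    assume ?R
    then obtain c where c: "\<And>x. x \<in> pverts G \<Longrightarrow> c x < k"
      and cs: "\<And>i. i < k \<Longrightarrow> card {x \<in> pverts G. c x = i} = s i"
      and cE: "\<And>x y. x \<in> pverts G \<Longrightarrow> y \<in> pverts G \<Longrightarrow> x \<noteq> y \<Longrightarrow>
        (x, y) \<in> parcs G \<longleftrightarrow> c x = c y"
      unfolding multipartite_colouring_def by blast
    have "\<exists>f. bij_betw f {x \<in> pverts G. c x = i} {..<s i}" if "i < k" for i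
      using cs[OF that] G.pair_finite_verts by (intro finite_same_card_bij) auto
    then obtain f where f: "\<And>i. i < k \<Longrightarrow> bij_betw (f i) {x \<in> pverts G. c x = i} {..<s i}"
      by metis
    define h where "h x = (c x, f (c x) x)" for x
    have hV: "h x \<in> ?V" if "x \<in> pverts G" for x
      using f[OF c[OF that]] c[OF that] that unfolding h_def bij_betw_def by auto
    have inj: "inj_on h (pverts G)"
    proof (rule inj_onI)
      fix x y assume xy: "x \<in> pverts G" "y \<in> pverts G" "h x = h y"
      then have "c x = c y" "f (c x) x = f (c x) y" unfolding h_def by auto
      then show "x = y"
        using f[OF c[OF xy(1)]] xy unfolding bij_betw_def by (auto dest: inj_onD)
    qed
    have "?V \<subseteq> h ` pverts G"
    proof
      fix z assume "z \<in> ?V"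
      then obtain i j where z: "z = (i, j)" "i < k" "j < s i" by auto
      then have "j \<in> f i ` {x \<in> pverts G. c x = i}" using f[of i] unfolding bij_betw_def by auto
      then show "z \<in> h ` pverts G" using z unfolding h_def by auto
    qed
    then have "bij_betw h (pverts G) ?V" using hV inj unfolding bij_betw_def by blast
    moreover have "(u, v) \<in> parcs G \<longleftrightarrow> (h u, h v) \<in> parcs ?H"
      if uv: "u \<in> pverts G" "v \<in> pverts G" for u v
    proof (cases "u = v")
      case True
      \<comment> \<open>On the diagonal both sides are false, since neither graph has loops.\<close>
      then show ?thesis using G.no_loops' unfolding paH by auto
    next
      case False
      then have "h u \<noteq> h v" using inj uv by (auto dest: inj_onD)
      then have "(h u, h v) \<in> parcs ?H \<longleftrightarrow> c u = c v"
        using hV[OF uv(1)] hV[OF uv(2)] unfolding paH by (simp add: h_def)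
      then show ?thesis using cE[OF uv False] by simp
    qed
    ultimately show "\<exists>h. bij_betw h (pverts G) ?V \<and>
      (\<forall>u\<in>pverts G. \<forall>v\<in>pverts G. (u, v) \<in> parcs G \<longleftrightarrow> (h u, h v) \<in> parcs ?H)"
      by blast
  qed
qed

section \<open>Maximum independent sets\<close>

lemma indep_card_le_independence_number:
  assumes "pair_graph G" "indep_set G S"
  shows "card S \<le> independence_number G"
proof -
  interpret pair_graph G by fact
  have "{card S | S. indep_set G S} \<subseteq> card ` Pow (pverts G)" unfolding indep_set_def by auto
  then have "finite {card S | S. indep_set G S}"
    using pair_finite_verts by (meson finite_Pow_iff finite_imageI finite_subset)
  then show ?thesis unfolding independence_number_def using assms(2) by (intro Max_ge) auto
qed

lemma ceiling_of_nat_div: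
  assumes "k > 0" "n mod k > 0"
  shows "\<lceil>real n / real k\<rceil> = int (n div k) + 1"
proof -
  have "real n = real k * real (n div k) + real (n mod k)"
    by (metis mult_div_mod_eq of_nat_add of_nat_mult)
  moreover have "real (n mod k) < real k" using assms by simp
  ultimately show ?thesis
    using assms by (intro ceiling_unique) (simp_all add: field_simps)
qed

theorem corollary2:
  fixes G :: "'a pair_pre_digraph" and n \<alpha> :: nat
  assumes "pair_graph G"
    and "graph_order G = n"
    and "independence_number G = \<alpha>"
    and "\<alpha> < n"
  shows "int (num_max_indep_sets G)
           \<le> \<lceil>real n / real \<alpha>\<rceil> ^ (n mod \<alpha>) * \<lfloor>real n / real \<alpha>\<rfloor> ^ (\<alpha> - n mod \<alpha>)
       \<and> (int (num_max_indep_sets G)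
           = \<lceil>real n / real \<alpha>\<rceil> ^ (n mod \<alpha>) * \<lfloor>real n / real \<alpha>\<rfloor> ^ (\<alpha> - n mod \<alpha>)
         \<longleftrightarrow> digraph_iso (with_proj G) (with_proj (complement_graph (turan_graph \<alpha> n))))"
proof -
  interpret G: pair_graph G by fact
  let ?E = "\<lambda>u v. (u, v) \<notin> parcs G"
  let ?V = "pverts G"
  define q where "q = n div \<alpha>"
  define r where "r = n mod \<alpha>"
  define t where "t i = (if i < r then q + 1 else q)" for i
  have cardV: "card ?V = n" using assms(2) unfolding graph_order_def .
  have finV: "finite ?V" by (rule G.pair_finite_verts)
  obtain v where "v \<in> ?V" using cardV assms(4) by fastforce
  then have "indep_set G {v}" unfolding indep_set_def by simp
  \<comment> \<open>A single vertex is independent, which rules out division by 0.\<close>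
  then have \<alpha>: "\<alpha> > 0" using indep_card_le_independence_number[OF assms(1)] assms(3) by fastforce
  have r: "r < \<alpha>" unfolding r_def using \<alpha> by simp
  have q: "q > 0" unfolding q_def using \<alpha> assms(4) by (simp add: div_greater_zero_iff)
  have bound: "\<lceil>real n / real \<alpha>\<rceil> ^ (n mod \<alpha>) * \<lfloor>real n / real \<alpha>\<rfloor> ^ (\<alpha> - n mod \<alpha>)
      = int ((q + 1) ^ r * q ^ (\<alpha> - r))"
  proof -
    \<comment> \<open>If \<open>\<alpha>\<close> divides \<open>n\<close>, the ceiling is
      \<open>q\<close> and not \<open>q + 1\<close>, but then the exponent is 0 and both powers are
      1.\<close>
    have "\<lceil>real n / real \<alpha>\<rceil> ^ r = int (q + 1) ^ r"
      using ceiling_of_nat_div[OF \<alpha>, of n] unfolding q_def r_def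
      by (cases "n mod \<alpha> = 0") (auto simp: add.commute)
    then show ?thesis
      unfolding r_def q_def by (simp add: floor_divide_of_nat_eq)
  qed
  have turan: "turan_graph \<alpha> n = complete_multipartite \<alpha> t"
  proof -
    have "(if i < n mod \<alpha> then nat \<lceil>real n / real \<alpha>\<rceil> else nat \<lfloor>real n / real \<alpha>\<rfloor>) = t i" for i
      using ceiling_of_nat_div[OF \<alpha>, of n] unfolding t_def q_def r_def
      by (auto simp: floor_divide_of_nat_eq nat_add_distrib)
    then show ?thesis unfolding turan_graph_def by presburger
  qed
  have num: "num_max_indep_sets G = card (cliques ?E \<alpha> ?V)"
    unfolding num_max_indep_sets_def max_indep_set_def indep_set_def cliques_def assms(3)
    by (rule arg_cong[of _ _ card]) auto
  have empty: "cliques ?E (Suc \<alpha>) ?V = {}"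
  proof -
    have False if "S \<in> cliques ?E (Suc \<alpha>) ?V" for S
    proof -
      have "indep_set G S" "card S = Suc \<alpha>" using that unfolding cliques_def indep_set_def by auto
      then show False using indep_card_le_independence_number[OF assms(1)] assms(3) by fastforce
    qed
    then show ?thesis by blast
  qed
  have sym: "?E x y \<Longrightarrow> ?E y x" for x y
    using G.pair_sym_arcs unfolding symmetric_def with_proj_simps by (blast dest: symD)
  obtain s where s: "sum s {..<\<alpha>} = n" and le: "card (cliques ?E \<alpha> ?V) \<le> prod s {..<\<alpha>}"
    and col: "card (cliques ?E \<alpha> ?V) = prod s {..<\<alpha>} \<Longrightarrow> card (cliques ?E \<alpha> ?V) > 0 \<Longrightarrow>
      (\<exists>c. multipartite_colouring ?E ?V \<alpha> s c)"
    using card_cliques_le_prod[of ?V ?E, OF finV sym empty] unfolding cardV by blast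
  have le': "prod s {..<\<alpha>} \<le> (q + 1) ^ r * q ^ (\<alpha> - r)"
    and bal: "prod s {..<\<alpha>} = (q + 1) ^ r * q ^ (\<alpha> - r) \<Longrightarrow> i < \<alpha> \<Longrightarrow> s i = q \<or> s i = q + 1" for i
    using prod_le_balanced[OF \<alpha> s] assms(4) unfolding q_def r_def by auto
  have "card (cliques ?E \<alpha> ?V) = (q + 1) ^ r * q ^ (\<alpha> - r) \<longleftrightarrow>
      (\<exists>c. multipartite_colouring ?E ?V \<alpha> t c)"
  proof
    assume eq: "card (cliques ?E \<alpha> ?V) = (q + 1) ^ r * q ^ (\<alpha> - r)"
    \<comment> \<open>As \<open>q > 0\<close>, the bound is positive, so the equality clause
      \<open>col\<close> applies.\<close>
    then have "card (cliques ?E \<alpha> ?V) > 0" using q by simp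
    then obtain c where c: "multipartite_colouring ?E ?V \<alpha> s c" using eq le le' col by auto
    obtain p where "bij_betw p {..<\<alpha>} {..<\<alpha>}" "\<And>i. i < \<alpha> \<Longrightarrow> s i = t (p i)"
      using balanced_permutation[OF \<alpha> s] bal eq le le' unfolding t_def q_def r_def by fastforce
    then show "\<exists>c. multipartite_colouring ?E ?V \<alpha> t c"
      using multipartite_colouring_permute[OF c] by blast
  next
    assume "\<exists>c. multipartite_colouring ?E ?V \<alpha> t c"
    then have "card (cliques ?E \<alpha> ?V) = prod t {..<\<alpha>}" using card_cliques_eq_prod[OF finV] by blast
    also have "{..<\<alpha>} = {..<r} \<union> {r..<\<alpha>}" using r by auto
    also have "prod t ({..<r} \<union> {r..<\<alpha>}) = prod t {..<r} * prod t {r..<\<alpha>}"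
      by (rule prod.union_disjoint) auto
    also have "\<dots> = (q + 1) ^ r * q ^ (\<alpha> - r)" unfolding t_def by simp
    finally show "card (cliques ?E \<alpha> ?V) = (q + 1) ^ r * q ^ (\<alpha> - r)" .
  qed
  then show ?thesis
    unfolding bound num turan iso_complement_multipartite_iff[OF assms(1)]
    using le le' by (simp only: of_nat_le_iff of_nat_eq_iff) auto
qed

end
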